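(* Fix a chess piece, called a chiece. If there exists an $n\times n$ chiece Latin square, then for every positive integer $m$ there exists an $nm\times nm$ chiece Latin square.
   Context: A Latin square of order $n$ is an $n\times n$ table filled with the integers $1,\dots,n$ so that each integer appears exactly once in each row and in each column. "Chiece" stands for an unspecified chess piece (king, queen, rook, bishop or knight) with its usual chess moves on the $n\times n$ board (no wrap-around; moves are regarded as unobstructed by other cells). A chiece Latin square is a Latin square such that for each cell there is another cell containing the same number that is a chiece's move apart from it. *)

theory Defs
  imports Main
begin

text \<open>An \<open>n \<times> n\<close> table is a function of a row and a column index;
  only its values at indices in \<open>{1..n}\<close> are constrained.\<close>

definition latin_square :: "nat \<Rightarrow> (nat \<Rightarrow> nat \<Rightarrow> nat) \<Rightarrow> bool" where
  "latin_square n L \<longleftrightarrow>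
     (\<forall>i\<in>{1..n}. \<forall>j\<in>{1..n}. L i j \<in> {1..n}) \<and>
     (\<forall>i\<in>{1..n}. \<forall>k\<in>{1..n}. \<exists>!j. j \<in> {1..n} \<and> L i j = k) \<and>
     (\<forall>j\<in>{1..n}. \<forall>k\<in>{1..n}. \<exists>!i. i \<in> {1..n} \<and> L i j = k)"

datatype chiece = King | Queen | Rook | Bishop | Knight

text \<open>The arguments are the row and column displacements. Intermediate cells play no role.\<close>

fun chess_move :: "chiece \<Rightarrow> int \<Rightarrow> int \<Rightarrow> bool" where
  "chess_move King dx dy \<longleftrightarrow> max \<bar>dx\<bar> \<bar>dy\<bar> = 1"
| "chess_move Rook dx dy \<longleftrightarrow> (dx = 0 \<and> dy \<noteq> 0) \<or> (dx \<noteq> 0 \<and> dy = 0)"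
| "chess_move Bishop dx dy \<longleftrightarrow> dx \<noteq> 0 \<and> \<bar>dx\<bar> = \<bar>dy\<bar>"
| "chess_move Queen dx dy \<longleftrightarrow> (dx = 0 \<and> dy \<noteq> 0) \<or> (dx \<noteq> 0 \<and> dy = 0) \<or> (dx \<noteq> 0 \<and> \<bar>dx\<bar> = \<bar>dy\<bar>)"
| "chess_move Knight dx dy \<longleftrightarrow> (\<bar>dx\<bar> = 1 \<and> \<bar>dy\<bar> = 2) \<or> (\<bar>dx\<bar> = 2 \<and> \<bar>dy\<bar> = 1)"

definition chiece_latin_square :: "chiece \<Rightarrow> nat \<Rightarrow> (nat \<Rightarrow> nat \<Rightarrow> nat) \<Rightarrow> bool" where
  "chiece_latin_square c n L \<longleftrightarrow> latin_square n L \<and>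
     (\<forall>i\<in>{1..n}. \<forall>j\<in>{1..n}. \<exists>i'\<in>{1..n}. \<exists>j'\<in>{1..n}.
        (i', j') \<noteq> (i, j) \<and> L i' j' = L i j \<and>
        chess_move c (int i' - int i) (int j' - int j))"

end

(* Inflate an n x n square L to an m x m array of blocks. Block (a, b) is a copy of L whose entries
   are shifted by n * ((a + b) mod m), so the blocks are arranged according to the addition table
   of the integers modulo m. A cell finds its partner inside its own block, where displacements
   agree with those in L. *)

theory Submission
  imports Defs
begin

text \<open>Congruence makes \<open>m\<close> divide the difference of \<open>a\<close> and
  \<open>b\<close>, which is smaller than \<open>m\<close> and hence zero. This is injectivity of
  the rows in the addition table modulo \<open>m\<close>.\<close>

lemma nat_mod_add_left_cancel:
  fixes a b k m :: nat
  assumes "(k + a) mod m = (k + b) mod m" "a < m" "b < m"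
  shows "a = b"
proof -
  have *: "x = y" if "x \<le> y" "y < m" "(k + y) mod m = (k + x) mod m" for x y
  proof -
    have "m dvd (k + y) - (k + x)"
      using that mod_eq_dvd_iff_nat[of "k + x" "k + y" m] by simp
    then show ?thesis
      using that by (auto dest: dvd_imp_le)
  qed
  show ?thesis
    using assms *[of a b] *[of b a] by (cases "a \<le> b") auto
qed

text \<open>An injective self-map of a finite set is surjective, so every \<open>k\<close> has a
  preimage, and injectivity makes it unique.\<close>

lemma inj_on_imp_ex1:
  assumes "finite A" "f ` A \<subseteq> A" "inj_on f A" "k \<in> A"
  shows "\<exists>!x. x \<in> A \<and> f x = k"
proof -
  have "k \<in> f ` A"
    using assms by (simp add: endo_inj_surj)
  then obtain x where "x \<in> A" "f x = k"
    by blast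
  then show ?thesis
    using assms(3) by (intro ex1I[of _ x]) (auto simp: inj_on_def)
qed

text \<open>By the pigeonhole principle, a row or column with entries in \<open>{1..n}\<close> and
  no repetition contains each number. Checking an inflated square thus reduces to range and
  injectivity.\<close>

lemma latin_square_iff_inj_on:
  "latin_square n L \<longleftrightarrow>
     (\<forall>i\<in>{1..n}. \<forall>j\<in>{1..n}. L i j \<in> {1..n}) \<and>
     (\<forall>i\<in>{1..n}. inj_on (L i) {1..n}) \<and>
     (\<forall>j\<in>{1..n}. inj_on (\<lambda>i. L i j) {1..n})" (is "_ \<longleftrightarrow> ?R")
proof
  assume L: "latin_square n L"
  have "\<forall>i\<in>{1..n}. \<forall>j\<in>{1..n}. L i j \<in> {1..n}"
    using L unfolding latin_square_def by (rule conjunct1)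
  moreover have "\<forall>i\<in>{1..n}. inj_on (L i) {1..n}"
  proof (intro ballI inj_onI)
    fix i j j' assume "i \<in> {1..n}" "j \<in> {1..n}" "j' \<in> {1..n}" "L i j = L i j'"
    with L show "j = j'"
      unfolding latin_square_def by blast
  qed
  moreover have "\<forall>j\<in>{1..n}. inj_on (\<lambda>i. L i j) {1..n}"
  proof (intro ballI inj_onI)
    fix j i i' assume "j \<in> {1..n}" "i \<in> {1..n}" "i' \<in> {1..n}" "L i j = L i' j"
    with L show "i = i'"
      unfolding latin_square_def by blast
  qed
  ultimately show ?R
    by (intro conjI)
next
  assume R: ?R
  then have "\<forall>i\<in>{1..n}. \<forall>j\<in>{1..n}. L i j \<in> {1..n}"
    by (rule conjunct1)
  moreover have "\<forall>i\<in>{1..n}. \<forall>k\<in>{1..n}. \<exists>!j. j \<in> {1..n} \<and> L i j = k"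
    using R by (intro ballI inj_on_imp_ex1 image_subsetI) simp_all
  moreover have "\<forall>j\<in>{1..n}. \<forall>k\<in>{1..n}. \<exists>!i. i \<in> {1..n} \<and> L i j = k"
    using R by (intro ballI inj_on_imp_ex1 image_subsetI) simp_all
  ultimately show "latin_square n L"
    unfolding latin_square_def by (intro conjI)
qed

text \<open>Indices start at 1, hence the shift before dividing. Blocks are numbered from 0 to fit
  arithmetic modulo \<open>m\<close>, while offsets start at 1 so that they are indices of the small
  square.\<close>

definition block :: "nat \<Rightarrow> nat \<Rightarrow> nat" where
  "block n i = (i - 1) div n"

definition offset :: "nat \<Rightarrow> nat \<Rightarrow> nat" where
  "offset n i = (i - 1) mod n + 1"

lemma block_offset_unique [simp]:
  assumes "u \<in> {1..n}"
  shows "block n (a * n + u) = a" "offset n (a * n + u) = u"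
proof -
  obtain w where "u = Suc w" "w < n"
    using assms by (cases u) auto
  then show "block n (a * n + u) = a" "offset n (a * n + u) = u"
    by (simp_all add: block_def offset_def)
qed

lemma block_offset_eq:
  assumes "i \<ge> 1"
  shows "block n i * n + offset n i = i"
  using assms div_mult_mod_eq[of "i - 1" n] by (simp add: block_def offset_def)

lemma
  assumes "i \<in> {1..n * m}"
  shows block_less: "block n i < m" and offset_mem: "offset n i \<in> {1..n}"
proof -
  \<comment> \<open>The interval containing \<open>i\<close> is nonempty, which rules out
    \<open>n = 0\<close>.\<close>
  have "n > 0" "i - 1 < m * n"
    using assms by (auto intro: Nat.gr0I simp: mult.commute)
  then show "block n i < m" "offset n i \<in> {1..n}"
    by (auto simp: block_def offset_def less_mult_imp_div_less Suc_le_eq)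
qed

lemma mult_add_mem_atLeastAtMost:
  fixes a m n u :: nat
  assumes "a < m" "u \<in> {1..n}"
  shows "a * n + u \<in> {1..n * m}"
proof -
  have "a * n + u \<le> Suc a * n"
    using assms by simp
  also have "\<dots> \<le> m * n"
    using assms by (intro mult_le_mono1) simp
  finally show ?thesis
    using assms by (simp add: mult.commute)
qed

definition inflate :: "nat \<Rightarrow> nat \<Rightarrow> (nat \<Rightarrow> nat \<Rightarrow> nat) \<Rightarrow> nat \<Rightarrow> nat \<Rightarrow> nat" where
  "inflate n m L i j =
     ((block n i + block n j) mod m) * n + L (offset n i) (offset n j)"

text \<open>Addition modulo \<open>m\<close> is commutative, so the block pattern is symmetric and
  transposing \<open>L\<close> transposes the whole inflation. Columns can then be treated as
  rows.\<close>

lemma inflate_transpose: "inflate n m (\<lambda>i j. L j i) j = (\<lambda>i. inflate n m L i j)"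
  by (rule ext) (simp add: inflate_def add.commute)

text \<open>An entry is itself in block-plus-offset form, since values of \<open>L\<close> lie in
  \<open>{1..n}\<close>. Equal entries therefore agree in both parts: the block part determines the
  block of the column, and the offset part its position inside the block.\<close>

lemma inj_on_inflate_row:
  assumes mem: "\<And>i j. i \<in> {1..n} \<Longrightarrow> j \<in> {1..n} \<Longrightarrow> L i j \<in> {1..n}"
    and inj: "\<And>i. i \<in> {1..n} \<Longrightarrow> inj_on (L i) {1..n}"
    and i: "i \<in> {1..n * m}"
  shows "inj_on (inflate n m L i) {1..n * m}"
proof (rule inj_onI)
  fix j j'
  assume j: "j \<in> {1..n * m}" and j': "j' \<in> {1..n * m}"
    and eq: "inflate n m L i j = inflate n m L i j'"
  note L_mem = mem[OF offset_mem[OF i] offset_mem[OF j]] mem[OF offset_mem[OF i] offset_mem[OF j']]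
  have "(block n i + block n j) mod m = (block n i + block n j') mod m"
    using arg_cong[OF eq, of "block n"] L_mem by (simp add: inflate_def del: atLeastAtMost_iff)
  then have "block n j = block n j'"
    using nat_mod_add_left_cancel block_less[OF j] block_less[OF j'] by blast
  moreover have "L (offset n i) (offset n j) = L (offset n i) (offset n j')"
    using arg_cong[OF eq, of "offset n"] L_mem by (simp add: inflate_def del: atLeastAtMost_iff)
  then have "offset n j = offset n j'"
    using inj_onD[OF inj[OF offset_mem[OF i]]] offset_mem[OF j] offset_mem[OF j'] by blast
  ultimately have "block n j * n + offset n j = block n j' * n + offset n j'"
    by simp
  then show "j = j'"
    using j j' by (simp add: block_offset_eq)
qed

lemma latin_square_inflate:
  assumes "latin_square n L"
  shows "latin_square (n * m) (inflate n m L)"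
proof -
  have mem: "L i j \<in> {1..n}" if "i \<in> {1..n}" "j \<in> {1..n}" for i j
    using assms that unfolding latin_square_iff_inj_on by blast
  have rows: "inj_on (L i) {1..n}" and cols: "inj_on (\<lambda>i. L i j) {1..n}"
    if "i \<in> {1..n}" "j \<in> {1..n}" for i j
    using assms that unfolding latin_square_iff_inj_on by blast+
  have "\<forall>i\<in>{1..n * m}. \<forall>j\<in>{1..n * m}. inflate n m L i j \<in> {1..n * m}"
  proof (intro ballI)
    fix i j assume i: "i \<in> {1..n * m}" and j: "j \<in> {1..n * m}"
    \<comment> \<open>The bound on \<open>block n i\<close> forces \<open>m > 0\<close>, so the
      residue modulo \<open>m\<close> is a valid block number.\<close>
    show "inflate n m L i j \<in> {1..n * m}"
      unfolding inflate_def using block_less[OF i] mem[OF offset_mem[OF i] offset_mem[OF j]]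
      by (intro mult_add_mem_atLeastAtMost) simp_all
  qed
  moreover have "\<forall>i\<in>{1..n * m}. inj_on (inflate n m L i) {1..n * m}"
    by (intro ballI inj_on_inflate_row mem rows)
  moreover have "\<forall>j\<in>{1..n * m}. inj_on (\<lambda>i. inflate n m L i j) {1..n * m}"
    \<comment> \<open>Column \<open>j\<close> is row \<open>j\<close> of the inflated transpose,
      whose small rows are the columns of \<open>L\<close>.\<close>
    by (subst inflate_transpose[symmetric]) (intro ballI inj_on_inflate_row mem cols)
  ultimately show ?thesis
    unfolding latin_square_iff_inj_on by (intro conjI)
qed

lemma chiece_latin_square_inflate:
  assumes "chiece_latin_square c n L"
  shows "chiece_latin_square c (n * m) (inflate n m L)"
  unfolding chiece_latin_square_def
proof (intro conjI ballI)
  show "latin_square (n * m) (inflate n m L)"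
    using assms by (simp add: chiece_latin_square_def latin_square_inflate)
next
  fix i j
  assume i: "i \<in> {1..n * m}" and j: "j \<in> {1..n * m}"
  \<comment> \<open>The partner of the corresponding cell in \<open>L\<close> is carried back into
    the block containing \<open>(i, j)\<close>.\<close>
  obtain u v where uv: "u \<in> {1..n}" "v \<in> {1..n}" "(u, v) \<noteq> (offset n i, offset n j)"
    "L u v = L (offset n i) (offset n j)"
    "chess_move c (int u - int (offset n i)) (int v - int (offset n j))"
    using assms offset_mem[OF i] offset_mem[OF j] unfolding chiece_latin_square_def by blast
  define i' where "i' = block n i * n + u"
  define j' where "j' = block n j * n + v"
  have coords: "block n i' = block n i" "offset n i' = u" "block n j' = block n j" "offset n j' = v"
    using uv by (simp_all add: i'_def j'_def del: atLeastAtMost_iff)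
  have "i' \<in> {1..n * m}" "j' \<in> {1..n * m}"
    unfolding i'_def j'_def using uv block_less[OF i] block_less[OF j]
    by (simp_all only: mult_add_mem_atLeastAtMost)
  \<comment> \<open>If the two cells coincided, so would their offsets, contrary to the choice of
    \<open>(u, v)\<close>.\<close>
  moreover have "(i', j') \<noteq> (i, j)"
    using uv(3) coords by auto
  moreover have "inflate n m L i' j' = inflate n m L i j"
    using uv(4) by (simp add: inflate_def coords)
  \<comment> \<open>Both cells lie in the same block, so the multiples of \<open>n\<close>
    cancel.\<close>
  moreover have "int i' - int i = int u - int (offset n i)" "int j' - int j = int v - int (offset n j)"
    using i j arg_cong[OF block_offset_eq[of i n], of int] arg_cong[OF block_offset_eq[of j n], of int]
    unfolding i'_def j'_def by simp_all
  then have "chess_move c (int i' - int i) (int j' - int j)"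
    using uv(5) by (simp only:)
  ultimately show "\<exists>i'\<in>{1..n * m}. \<exists>j'\<in>{1..n * m}. (i', j') \<noteq> (i, j) \<and>
      inflate n m L i' j' = inflate n m L i j \<and> chess_move c (int i' - int i) (int j' - int j)"
    by blast
qed

theorem theorem20:
  fixes c :: chiece and n :: nat
  assumes "\<exists>L. chiece_latin_square c n L"
  shows "\<forall>m::nat. m \<ge> 1 \<longrightarrow> (\<exists>L. chiece_latin_square c (n * m) L)"
  using assms chiece_latin_square_inflate by blast

end
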